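(* Suppose that $G$ is an abelian group, $A\subset G$ is finite with $|A+A|\leq K|A|$, and $\eta\in(0,1]$. Then there is a set $\mathcal{L}\subset G$ such that $$|A\cap \operatorname{Span}(\mathcal{L})|\;\geq\; K^{-O(\exp(O(\eta^{-1})))}\,|A| \qquad\text{and}\qquad |\mathcal{L}|=O(K^{\eta}\log|A|).$$
   Context: For an abelian group $G$ and $A\subset G$, $A+A:=\{a+a' : a,a'\in A\}$. For $\mathcal{L}\subset G$, $$\operatorname{Span}(\mathcal{L}):=\Big\{\sum_{x\in\mathcal{L}}\sigma_x\, x \;:\; \sigma_x\in\{-1,0,1\}\text{ for all }x\in\mathcal{L}\Big\}.$$ The constants implied by the $O(\cdot)$ notation are absolute (independent of $G$, $A$, $K$ and $\eta$).
   Formalization: The case |A| = 1 is excluded: there log|A| = 0 forces the set L to be empty with Span {0}, so the claim fails for A = {a} with a ≠ 0 and K = 1. *)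

theory Defs
  imports Complex_Main "HOL-Algebra.Coset" "HOL-Algebra.FiniteProduct"
begin

text \<open>
  Groups are written multiplicatively, as in HOL-Algebra: the sumset \<open>A + A\<close> is the
  product set \<open>A <#>\<^bsub>G\<^esub> A\<close>, and \<open>\<sigma>\<^sub>x x\<close> is the integer power \<open>x [^]\<^bsub>G\<^esub> \<sigma> x\<close>.
  Meaningful for finite \<open>L\<close> only: \<open>finprod\<close> over an infinite set is \<open>\<one>\<close> by convention.
\<close>

definition signed_span :: "('a, 'b) monoid_scheme \<Rightarrow> 'a set \<Rightarrow> 'a set" where
  "signed_span G L =
     {finprod G (\<lambda>x. x [^]\<^bsub>G\<^esub> \<sigma> x) L | \<sigma> :: 'a \<Rightarrow> int. \<forall>x\<in>L. \<sigma> x \<in> {-1, 0, 1}}"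

text \<open>
  The implied constants are the same for all abelian groups. A formula
  \<open>\<exists>C. \<forall>G. \<dots>\<close> lets \<open>C\<close> depend on the type of the elements of \<open>G\<close>, since HOL does
  not quantify over types under \<open>\<exists>\<close>. To exclude that, \<open>C\<close> is named by a closed term:
  some constant that works for every abelian group with carrier in \<open>nat\<close>. The choice of
  \<open>nat\<close> loses nothing: a finite set \<open>A\<close> lies in the countable subgroup that it generates,
  so a constant that works for all groups exists iff one exists for countable groups, and
  every constant of the latter kind is of the former kind. If no such constant existed,
  the value of \<open>SOME\<close> would be unspecified.

  One \<open>C\<close> serves as all three implied constants; it may be increased, as
  \<open>K \<ge> 1\<close> whenever \<open>A\<close> is nonempty. Singletons are left out: there \<open>log |A| = 0\<close> would
  force \<open>L = {}\<close>, whose span is \<open>{\<one>}\<close>, and the claim fails for \<open>A = {a}\<close>, \<open>a \<noteq> \<one>\<close>, \<open>K = 1\<close>.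
\<close>

definition implied_const :: real where
  "implied_const = (SOME C. 0 < C \<and>
     (\<forall>(G :: nat monoid) A K \<eta>.
        comm_group G \<longrightarrow> A \<subseteq> carrier G \<longrightarrow> finite A \<longrightarrow> card A \<noteq> 1 \<longrightarrow>
        real (card (A <#>\<^bsub>G\<^esub> A)) \<le> K * real (card A) \<longrightarrow> 0 < \<eta> \<longrightarrow> \<eta> \<le> 1 \<longrightarrow>
        (\<exists>L. L \<subseteq> carrier G \<and> finite L \<and>
           real (card (A \<inter> signed_span G L)) \<ge> K powr (- (C * exp (C / \<eta>))) * real (card A) \<and>
           real (card L) \<le> C * (K powr \<eta> * ln (real (card A))))))"

end

theory Submission
  imports Defs "HOL-Analysis.Finite_Cartesian_Product"
begin

text \<open>
  Call a set dissociated if its subset sums are distinct. A maximal dissociated subset \<open>L\<close> of a set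
  \<open>X\<close> satisfies \<open>X \<subseteq> Span(L)\<close>, so it suffices to find a large \<open>X \<subseteq> A\<close> all of whose dissociated
  subsets are small. This holds as soon as each \<open>x \<in> X\<close> satisfies \<open>p + x \<in> Q\<close> for at least
  \<open>\<delta> (|P| + |Q|)\<close> elements \<open>p\<close> of \<open>P\<close>, where \<open>P\<close> and \<open>Q\<close> are finite sets. Indeed, the bipartite graph
  on \<open>P\<close> and \<open>Q\<close> in which \<open>p\<close> and \<open>q\<close> are joined if \<open>q - p \<in> L\<close> has a subgraph of minimum degree
  at least \<open>d = \<delta> |L|\<close>. It contains many walks of length \<open>m \<approx> d / 4\<close> with distinct labels, whereas
  dissociativity allows at most \<open>2 ^ m\<close> label sets for given endpoints; comparing the two counts gives
  \<open>d = O(log (|P| + |Q|))\<close>.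

  To find \<open>X\<close>, start with \<open>X = A\<close> and put \<open>S = X + A\<close>. If \<open>|S \<inter> (S + t)| \<ge> K powr -\<eta> * |S|\<close> for
  every popular difference \<open>t\<close> of \<open>X\<close>, then a positive proportion of \<open>X\<close>, with \<open>S\<close> and a translate of
  \<open>S\<close> in the roles of \<open>Q\<close> and \<open>P\<close>, is as desired. Otherwise replace \<open>X\<close> by \<open>X \<inter> (X + t)\<close> for a popular
  \<open>t\<close> that violates the inequality. As \<open>(X \<inter> (X + t)) + A \<subseteq> S \<inter> (S + t)\<close>, this makes \<open>|X + A|\<close> smaller
  by a factor \<open>K powr -\<eta>\<close>, which can happen at most \<open>1 / \<eta>\<close> times because \<open>|A| \<le> |X + A| \<le> K |A|\<close>
  throughout.
\<close>

section \<open>Dissociated sets\<close>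

text \<open>For finite \<open>L\<close> this is the usual condition that no nontrivial combination
  with coefficients in {-1, 0, 1} vanishes; the subset form suits counting inside
  \<open>Pow L\<close>.\<close>

definition dissociated :: "('a, 'b) monoid_scheme \<Rightarrow> 'a set \<Rightarrow> bool" where
  "dissociated G L \<longleftrightarrow> inj_on (finprod G (\<lambda>x. x)) (Pow L)"

context comm_group
begin

abbreviation prd :: "'a set \<Rightarrow> 'a" where
  "prd S \<equiv> finprod G (\<lambda>x. x) S"

lemma prd_closed [simp]: "S \<subseteq> carrier G \<Longrightarrow> prd S \<in> carrier G"
  by (rule finprod_closed) auto

lemma prd_insert:
  assumes "finite S" "x \<notin> S" "insert x S \<subseteq> carrier G"
  shows "prd (insert x S) = x \<otimes> prd S"
  using assms by (intro finprod_insert) auto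

text \<open>The exponent of \<open>x\<close> is the difference of the indicators of \<open>S\<close>
  and \<open>T\<close>; these may overlap, since common elements cancel.\<close>

lemma prd_quotient_in_signed_span:
  assumes L: "finite L" "L \<subseteq> carrier G" and S: "S \<subseteq> L" and T: "T \<subseteq> L"
  shows "prd S \<otimes> inv (prd T) \<in> signed_span G L"
proof -
  define \<sigma> where "\<sigma> = (\<lambda>x. of_bool (x \<in> S) - of_bool (x \<in> T) :: int)"
  have restrict: "finprod G (\<lambda>x. if x \<in> U then x else \<one>) L = prd U" if "U \<subseteq> L" for U
    using that L by (intro finprod_mono_neutral_cong_right) auto
  have closed: "(\<lambda>x. x [^] \<sigma> x) \<in> L \<rightarrow> carrier G"
    using L by auto
  have "finprod G (\<lambda>x. x [^] \<sigma> x) L \<otimes> prd T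
      = finprod G (\<lambda>x. x [^] \<sigma> x) L \<otimes> finprod G (\<lambda>x. if x \<in> T then x else \<one>) L"
    using restrict T by simp
  also have "\<dots> = finprod G (\<lambda>x. x [^] \<sigma> x \<otimes> (if x \<in> T then x else \<one>)) L"
    using L closed by (intro finprod_multf[symmetric]) auto
  also have "\<dots> = finprod G (\<lambda>x. if x \<in> S then x else \<one>) L"
  proof (rule finprod_cong')
    fix x assume "x \<in> L"
    then have "x \<in> carrier G" using L by auto
    then show "x [^] \<sigma> x \<otimes> (if x \<in> T then x else \<one>) = (if x \<in> S then x else \<one>)"
      by (auto simp: \<sigma>_def int_pow_neg)
  qed (use L in auto)
  also have "\<dots> = prd S"
    using restrict S by simp
  finally have "finprod G (\<lambda>x. x [^] \<sigma> x) L = prd S \<otimes> inv (prd T)"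
    using S T L finprod_closed[OF closed] by (simp add: inv_solve_right subset_trans)
  moreover have "\<forall>x\<in>L. \<sigma> x \<in> {-1, 0, 1}"
    by (auto simp: \<sigma>_def)
  ultimately show ?thesis
    unfolding signed_span_def by (auto intro!: exI[of _ \<sigma>])
qed

text \<open>If \<open>x\<close> lies in \<open>X\<close> but not in \<open>L\<close>, maximality
  gives two subsets of \<open>insert x L\<close> with equal products. Exactly one of them contains
  \<open>x\<close>, since otherwise removing \<open>x\<close> would leave a coincidence inside
  \<open>L\<close>; so the equation can be solved for \<open>x\<close>.\<close>

lemma maximal_dissociated:
  assumes X: "finite X" "X \<subseteq> carrier G"
  obtains L where "L \<subseteq> X" "dissociated G L" "X \<subseteq> signed_span G L"
proof -
  let ?D = "{L. L \<subseteq> X \<and> dissociated G L}"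
  have "finite ?D" using X by simp
  moreover have "{} \<in> ?D" by (auto simp: dissociated_def)
  ultimately obtain L where L: "L \<in> ?D" and max: "\<And>M. M \<in> ?D \<Longrightarrow> L \<subseteq> M \<Longrightarrow> L = M"
    by (metis (no_types, lifting) empty_iff finite_has_maximal)
  have fin: "finite L" and car: "L \<subseteq> carrier G"
    using L X finite_subset by auto
  have inj: "S = T" if "S \<subseteq> L" "T \<subseteq> L" "prd S = prd T" for S T
    using L that unfolding dissociated_def inj_on_def by auto
  have "x \<in> signed_span G L" if x: "x \<in> X" for x
  proof (cases "x \<in> L")
    case True
    then show ?thesis
      using prd_quotient_in_signed_span[of L "{x}" "{}"] fin car by (simp add: prd_insert subset_iff)
  next
    case False
    have xG: "x \<in> carrier G" using x X by auto
    have drop: "prd S = x \<otimes> prd (S - {x})" if "x \<in> S" "S \<subseteq> insert x L" for S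
    proof -
      have "prd (insert x (S - {x})) = x \<otimes> prd (S - {x})"
        using that fin car xG by (intro prd_insert) (auto intro: finite_subset)
      then show ?thesis using that by (simp add: insert_absorb)
    qed
    have "insert x L \<notin> ?D" using max False by blast
    then have "\<not> dissociated G (insert x L)" using x L by auto
    then obtain S T where ST: "S \<subseteq> insert x L" "T \<subseteq> insert x L" "prd S = prd T" "S \<noteq> T"
      unfolding dissociated_def inj_on_def by auto
    have "\<not> (x \<in> S \<longleftrightarrow> x \<in> T)"
    proof
      assume iff: "x \<in> S \<longleftrightarrow> x \<in> T"
      have sub: "S - {x} \<subseteq> L" "T - {x} \<subseteq> L" using ST by auto
      have "prd (S - {x}) = prd (T - {x})"
      proof (cases "x \<in> S")
        case True
        then have "x \<otimes> prd (S - {x}) = x \<otimes> prd (T - {x})"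
          using drop[of S] drop[of T] ST iff by simp
        then show ?thesis using xG sub car by (simp add: subset_trans)
      next
        case False
        then show ?thesis using ST iff by simp
      qed
      then have "S - {x} = T - {x}" using inj sub by blast
      then show False using iff ST(4) by auto
    qed
    then obtain U V where UV: "U \<subseteq> insert x L" "V \<subseteq> insert x L" "prd U = prd V" "x \<in> U" "x \<notin> V"
      using ST by metis
    have "x \<otimes> prd (U - {x}) = prd V" using drop[of U] UV by simp
    moreover have "U - {x} \<subseteq> L" "V \<subseteq> L" using UV by auto
    ultimately have "x = prd V \<otimes> inv (prd (U - {x}))"
      using xG car by (subst inv_solve_right) (auto simp: subset_iff)
    then show ?thesis
      using prd_quotient_in_signed_span[OF fin car] \<open>U - {x} \<subseteq> L\<close> \<open>V \<subseteq> L\<close> by metis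
  qed
  then show ?thesis using that L by blast
qed

text \<open>
  Each pair \<open>(S, T)\<close> yields \<open>2 ^ (card L - m)\<close> pairs \<open>(S \<union> U, T \<union> U)\<close> with the same quotient,
  and in all these pairs the first set determines the second.
\<close>

lemma card_signed_representations_le:
  assumes L: "finite L" "L \<subseteq> carrier G" "dissociated G L" and v: "v \<in> carrier G"
  shows "card {(S, T). S \<subseteq> L \<and> T \<subseteq> L \<and> S \<inter> T = {} \<and> card (S \<union> T) = m
            \<and> prd S \<otimes> inv (prd T) = v} \<le> 2 ^ m"
proof -
  define R where "R = {(S, T). S \<subseteq> L \<and> T \<subseteq> L \<and> S \<inter> T = {} \<and> card (S \<union> T) = m
            \<and> prd S \<otimes> inv (prd T) = v}"
  define W where "W = (SIGMA p:R. Pow (L - (fst p \<union> snd p)))"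
  define f where "f = (\<lambda>(p :: 'a set \<times> 'a set, U). fst p \<union> U)"
  have "R \<subseteq> Pow L \<times> Pow L" by (auto simp: R_def)
  then have finR: "finite R" by (rule finite_subset) (use L in simp)
  have cU: "card (Pow (L - (fst p \<union> snd p))) = 2 ^ (card L - m)" if "p \<in> R" for p
  proof -
    have "fst p \<union> snd p \<subseteq> L" "card (fst p \<union> snd p) = m" using that by (auto simp: R_def)
    then have "card (L - (fst p \<union> snd p)) = card L - m"
      using card_Diff_subset[of "fst p \<union> snd p" L] L(1) finite_subset by blast
    then show ?thesis using L by (simp add: card_Pow)
  qed
  have "card W = (\<Sum>p\<in>R. 2 ^ (card L - m))"
    unfolding W_def using finR L cU by (subst card_SigmaI) auto
  then have cW: "card W = card R * 2 ^ (card L - m)" by simp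
  have un: "prd (S \<union> U) = prd S \<otimes> prd U" if "S \<subseteq> L" "U \<subseteq> L - S" for S U
    using that L by (intro finprod_Un_disjoint) (auto intro: finite_subset)
  have quot: "prd (T \<union> U) \<otimes> v = prd (S \<union> U)" if "((S, T), U) \<in> W" for S T U
  proof -
    have sub: "S \<subseteq> L" "T \<subseteq> L" "U \<subseteq> L - S" "U \<subseteq> L - T" "prd S \<otimes> inv (prd T) = v"
      using that by (auto simp: W_def R_def)
    then have car: "prd S \<in> carrier G" "prd T \<in> carrier G" "prd U \<in> carrier G"
      using L(2) by (auto intro!: prd_closed)
    have "prd S = v \<otimes> prd T" using sub(5) car v by (metis inv_solve_right)
    then show ?thesis using un sub car v by (simp add: m_ac)
  qed
  have "inj_on f W"
  proof (rule inj_onI, clarify)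
    fix S T U S' T' U'
    assume w: "((S, T), U) \<in> W" and w': "((S', T'), U') \<in> W"
      and "f ((S, T), U) = f ((S', T'), U')"
    then have eq: "S \<union> U = S' \<union> U'" by (simp add: f_def)
    have sub: "T \<union> U \<subseteq> L" "T' \<union> U' \<subseteq> L" using w w' by (auto simp: W_def R_def)
    then have car: "prd (T \<union> U) \<in> carrier G" "prd (T' \<union> U') \<in> carrier G"
      using L(2) by (auto intro!: prd_closed)
    have "prd (T \<union> U) \<otimes> v = prd (T' \<union> U') \<otimes> v"
      using quot[OF w] quot[OF w'] eq by simp
    then have "prd (T \<union> U) = prd (T' \<union> U')" using v car by (simp add: right_cancel)
    then have eq': "T \<union> U = T' \<union> U'"
      using L(3) sub unfolding dissociated_def inj_on_def by auto
    \<comment> \<open>By disjointness \<open>U\<close> is the intersection of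
      \<open>S \<union> U\<close> and \<open>T \<union> U\<close>, and \<open>S\<close> and
      \<open>T\<close> are what remains of these unions.\<close>
    have "S \<inter> T = {}" "S' \<inter> T' = {}" "U \<inter> (S \<union> T) = {}" "U' \<inter> (S' \<union> T') = {}"
      using w w' by (auto simp: W_def R_def)
    then show "(S, T) = (S', T') \<and> U = U'" using eq eq' by blast
  qed
  moreover have "f ` W \<subseteq> Pow L" by (auto simp: f_def W_def R_def)
  ultimately have "card W \<le> card (Pow L)"
    using L by (meson card_inj_on_le finite_Pow_iff)
  then have *: "card R * 2 ^ (card L - m) \<le> 2 ^ card L" using cW L by (simp add: card_Pow)
  \<comment> \<open>A representation forces \<open>m \<le> card L\<close>, so that the subtraction
    in the exponent is not truncated; without one the bound is trivial.\<close>
  show ?thesis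
  proof (cases "R = {}")
    case False
    then obtain S T where "S \<union> T \<subseteq> L" "card (S \<union> T) = m" by (auto simp: R_def)
    then have "m \<le> card L" using L card_mono by blast
    then have "(2::nat) ^ card L = 2 ^ m * 2 ^ (card L - m)" by (simp flip: power_add)
    then show ?thesis using * unfolding R_def[symmetric] by simp
  qed (simp add: R_def[symmetric])
qed

end

section \<open>Counting in bipartite graphs\<close>

lemma double_counting_le:
  assumes "finite X" "finite Y"
    and "\<And>x. x \<in> X \<Longrightarrow> k \<le> card {y \<in> Y. R x y}"
    and "\<And>y. y \<in> Y \<Longrightarrow> card {x \<in> X. R x y} \<le> l"
  shows "k * card X \<le> l * card Y"
proof -
  have "k * card X \<le> (\<Sum>x\<in>X. card {y \<in> Y. R x y})"
    using sum_mono[of X "\<lambda>_. k"] assms(3) by (simp add: mult.commute)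
  also have "\<dots> = (\<Sum>y\<in>Y. card {x \<in> X. R x y})"
    using sum.swap_restrict[of X Y "\<lambda>_ _. 1::nat" R] assms(1,2) by simp
  also have "\<dots> \<le> l * card Y"
    using sum_mono[of Y _ "\<lambda>_. l"] assms(4) by (simp add: mult.commute)
  finally show ?thesis .
qed

text \<open>Deleting a vertex of degree at most \<open>k\<close> removes at most \<open>k\<close>
  edges, so the hypothesis survives and vertices can be deleted until none has small degree. Being
  strict, the edge bound always leaves an edge, whence \<open>P'\<close> is nonempty.\<close>

lemma min_degree_subgraph:
  fixes R :: "'a \<Rightarrow> 'b \<Rightarrow> bool"
  assumes "finite P" "finite Q"
    and "k * (card P + card Q) < card {(p, q) \<in> P \<times> Q. R p q}"
  obtains P' Q' where "P' \<subseteq> P" "Q' \<subseteq> Q" "P' \<noteq> {}"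
    "\<And>p. p \<in> P' \<Longrightarrow> k < card {q \<in> Q'. R p q}"
    "\<And>q. q \<in> Q' \<Longrightarrow> k < card {p \<in> P'. R p q}"
proof -
  define e where "e = (\<lambda>P Q. card {(p, q) \<in> P \<times> Q. R p q})"
  have fin: "finite {(p, q) \<in> P \<times> Q. R p q}" if "finite P" "finite Q" for P Q
    by (rule finite_subset[of _ "P \<times> Q"]) (use that in auto)
  have "\<exists>P' Q'. P' \<subseteq> P \<and> Q' \<subseteq> Q \<and> P' \<noteq> {} \<and> (\<forall>p\<in>P'. k < card {q \<in> Q'. R p q})
      \<and> (\<forall>q\<in>Q'. k < card {p \<in> P'. R p q})"
    using assms
  proof (induction "card P + card Q" arbitrary: P Q rule: less_induct)
    case less
    show ?case
    proof (cases "(\<forall>p\<in>P. k < card {q \<in> Q. R p q}) \<and> (\<forall>q\<in>Q. k < card {p \<in> P. R p q})")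
      case True
      have "P \<noteq> {}" using less.prems(3) by auto
      then show ?thesis using True by blast
    next
      case False
      then consider (P) p where "p \<in> P" "card {q \<in> Q. R p q} \<le> k"
        | (Q) q where "q \<in> Q" "card {p \<in> P. R p q} \<le> k"
        by (meson not_less)
      then show ?thesis
      proof cases
        case P
        have "{(p, q) \<in> P \<times> Q. R p q}
            = {(p', q) \<in> (P - {p}) \<times> Q. R p' q} \<union> Pair p ` {q \<in> Q. R p q}"
          using P(1) by auto
        then have "e P Q \<le> e (P - {p}) Q + card (Pair p ` {q \<in> Q. R p q})"
          unfolding e_def by (metis (no_types, lifting) card_Un_le)
        also have "card (Pair p ` {q \<in> Q. R p q}) \<le> k"
          using P(2) by (simp add: card_image inj_on_def)
        finally have "e P Q \<le> e (P - {p}) Q + k" by simp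
        moreover have "card P = Suc (card (P - {p}))"
          using P(1) less.prems(1) by (metis card_Suc_Diff1)
        moreover have "k * (card P + card Q) < e P Q" using less.prems(3) by (simp add: e_def)
        ultimately have "card (P - {p}) + card Q < card P + card Q"
          "k * (card (P - {p}) + card Q) < e (P - {p}) Q"
          by (simp_all add: algebra_simps)
        then show ?thesis
          using less.hyps[of "P - {p}" Q] less.prems(1,2) unfolding e_def by (meson Diff_subset finite_Diff subset_trans)
      next
        case Q
        have "{(p, q) \<in> P \<times> Q. R p q}
            = {(p, q') \<in> P \<times> (Q - {q}). R p q'} \<union> (\<lambda>p. (p, q)) ` {p \<in> P. R p q}"
          using Q(1) by auto
        then have "e P Q \<le> e P (Q - {q}) + card ((\<lambda>p. (p, q)) ` {p \<in> P. R p q})"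
          unfolding e_def by (metis (no_types, lifting) card_Un_le)
        also have "card ((\<lambda>p. (p, q)) ` {p \<in> P. R p q}) \<le> k"
          using Q(2) by (simp add: card_image inj_on_def)
        finally have "e P Q \<le> e P (Q - {q}) + k" by simp
        moreover have "card Q = Suc (card (Q - {q}))"
          using Q(1) less.prems(2) by (metis card_Suc_Diff1)
        moreover have "k * (card P + card Q) < e P Q" using less.prems(3) by (simp add: e_def)
        ultimately have "card P + card (Q - {q}) < card P + card Q"
          "k * (card P + card (Q - {q})) < e P (Q - {q})"
          by (simp_all add: algebra_simps)
        then show ?thesis
          using less.hyps[of P "Q - {q}"] less.prems(1,2) unfolding e_def by (meson Diff_subset finite_Diff subset_trans)
      qed
    qed
  qed
  then obtain P' Q' where "P' \<subseteq> P" "Q' \<subseteq> Q" "P' \<noteq> {}"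
    "\<forall>p\<in>P'. k < card {q \<in> Q'. R p q}" "\<forall>q\<in>Q'. k < card {p \<in> P'. R p q}" by blast
  then show ?thesis by (intro that[of P' Q']) auto
qed

section \<open>Walks labelled by a dissociated set\<close>

context comm_group
begin

text \<open>
  Walks with distinct labels that alternate between \<open>P\<close> and \<open>Q\<close> are recorded by the sets \<open>S\<close> and
  \<open>T\<close> of labels used in either direction; such a pair of size \<open>m\<close> extends in at least \<open>d - m\<close>
  ways and restricts in at most \<open>m\<close> ways, so there are at least \<open>d choose m\<close> of them.
\<close>

lemma binomial_le_min_degree:
  assumes L: "finite L" "L \<subseteq> carrier G" "dissociated G L"
    and P: "finite P" "P \<subseteq> carrier G" "P \<noteq> {}" and Q: "finite Q" "Q \<subseteq> carrier G"
    and degP: "\<And>p. p \<in> P \<Longrightarrow> d \<le> card {q \<in> Q. q \<otimes> inv p \<in> L}"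
    and degQ: "\<And>q. q \<in> Q \<Longrightarrow> d \<le> card {p \<in> P. q \<otimes> inv p \<in> L}"
    and N: "card P \<le> N" "card Q \<le> N" and m: "m \<le> d"
  shows "d choose m \<le> 2 ^ m * N"
proof -
  obtain s where s: "s \<in> P" "s \<in> carrier G" using P by auto
  \<comment> \<open>Walks start at \<open>s\<close>, and those of length \<open>m\<close> end in
    \<open>V m\<close>. A label multiplies on the way from \<open>P\<close> to \<open>Q\<close> and
    divides on the way back. Membership in \<open>F m\<close> constrains only the end point, not the
    vertices in between.\<close>
  define V where "V = (\<lambda>m::nat. if even m then P else Q)"
  have V: "finite (V m)" "V m \<subseteq> carrier G" "card (V m) \<le> N" for m
    using P Q N by (auto simp: V_def)
  define F where "F = (\<lambda>m. {(S, T). S \<subseteq> L \<and> T \<subseteq> L \<and> S \<inter> T = {} \<and> card (S \<union> T) = m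
    \<and> s \<otimes> (prd S \<otimes> inv (prd T)) \<in> V m})"
  have finF: "finite (F m)" for m
    by (rule finite_subset[of _ "Pow L \<times> Pow L"]) (use L in \<open>auto simp: F_def\<close>)
  have car: "prd S \<in> carrier G" "S \<subseteq> carrier G" "finite S" if "S \<subseteq> L" for S
    using that L finite_subset by (auto intro!: prd_closed)
  have upper: "card (F m) \<le> 2 ^ m * N" for m
  proof -
    define Rep where "Rep = (\<lambda>v. {(S, T). S \<subseteq> L \<and> T \<subseteq> L \<and> S \<inter> T = {} \<and> card (S \<union> T) = m
            \<and> prd S \<otimes> inv (prd T) = v})"
    have "F m \<subseteq> (\<Union>w\<in>V m. Rep (inv s \<otimes> w))"
    proof clarify
      fix S T assume ST: "(S, T) \<in> F m"
      let ?v = "prd S \<otimes> inv (prd T)"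
      have "?v \<in> carrier G" using ST car by (auto simp: F_def)
      then have "?v = inv s \<otimes> (s \<otimes> ?v)" using s by (simp add: m_assoc[symmetric])
      then show "(S, T) \<in> (\<Union>w\<in>V m. Rep (inv s \<otimes> w))"
        using ST by (auto simp: F_def Rep_def)
    qed
    moreover have "Rep v \<subseteq> Pow L \<times> Pow L" for v by (auto simp: Rep_def)
    then have "finite (Rep v)" for v using L(1) by (meson finite_Pow_iff finite_SigmaI finite_subset)
    ultimately have "card (F m) \<le> card (\<Union>w\<in>V m. Rep (inv s \<otimes> w))"
      using V by (intro card_mono) auto
    also have "\<dots> \<le> (\<Sum>w\<in>V m. card (Rep (inv s \<otimes> w)))"
      using V by (intro card_UN_le)
    also have "\<dots> \<le> (\<Sum>w\<in>V m. 2 ^ m)"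
    proof (rule sum_mono)
      fix w assume "w \<in> V m"
      then have "inv s \<otimes> w \<in> carrier G" using s V(2)[of m] by auto
      then show "card (Rep (inv s \<otimes> w)) \<le> 2 ^ m"
        using card_signed_representations_le[OF L] unfolding Rep_def by blast
    qed
    also have "\<dots> \<le> 2 ^ m * N" using V(3)[of m] by simp
    finally show ?thesis .
  qed
  have step: "(d - m) * card (F m) \<le> Suc m * card (F (Suc m))" for m
  proof (rule double_counting_le[OF finF finF])
    let ?R = "\<lambda>(S, T) (S', T').
      \<exists>x\<in>L - (S \<union> T). S' = insert x S \<and> T' = T \<or> S' = S \<and> T' = insert x T"
    fix Y assume "Y \<in> F (Suc m)"
    then obtain S' T' where Y: "Y = (S', T')" "finite (S' \<union> T')" "S' \<inter> T' = {}"
      "card (S' \<union> T') = Suc m"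
      using car by (auto simp: F_def)
    have "{X \<in> F m. ?R X Y} \<subseteq> (\<lambda>x. (S' - {x}, T' - {x})) ` (S' \<union> T')"
      using Y by (auto simp: image_iff)
    then have "card {X \<in> F m. ?R X Y} \<le> card (S' \<union> T')"
      using Y(2) by (meson surj_card_le)
    then show "card {X \<in> F m. ?R X Y} \<le> Suc m" using Y by simp
  next
    let ?R = "\<lambda>(S, T) (S', T').
      \<exists>x\<in>L - (S \<union> T). S' = insert x S \<and> T' = T \<or> S' = S \<and> T' = insert x T"
    fix X assume "X \<in> F m"
    then obtain S T where X: "X = (S, T)" "S \<subseteq> L" "T \<subseteq> L" "S \<inter> T = {}" "card (S \<union> T) = m"
      and end_in: "s \<otimes> (prd S \<otimes> inv (prd T)) \<in> V m"
      by (auto simp: F_def)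
    define v where "v = s \<otimes> (prd S \<otimes> inv (prd T))"
    have v: "v \<in> carrier G" "v \<in> V m" using end_in V(2) by (auto simp: v_def)
    note [simp] = car[OF X(2)] car[OF X(3)]
    \<comment> \<open>Here \<open>h\<close> sends a neighbour of the end point to its label, and
      \<open>f\<close> adds a label to the pair. At least \<open>d\<close> labels lead onward, and
      only the \<open>m\<close> labels in \<open>S \<union> T\<close> are already used.\<close>
    have main: "d - m \<le> card {Y \<in> F (Suc m). ?R X Y}"
      if "finite I" "d \<le> card I" "inj_on h I" "h ` I \<subseteq> L" "inj_on f (L - (S \<union> T))"
        "\<And>i. i \<in> I \<Longrightarrow> h i \<notin> S \<union> T \<Longrightarrow> f (h i) \<in> F (Suc m) \<and> ?R X (f (h i))" for I :: "'a set" and h f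
    proof -
      have "d - m \<le> card (h ` I) - card (S \<union> T)"
        using that(2,3) X(5) by (simp add: card_image)
      also have "\<dots> \<le> card (h ` I - (S \<union> T))"
        by (rule diff_card_le_card_Diff) simp
      also have "\<dots> = card (f ` (h ` I - (S \<union> T)))"
        using that(4,5) by (intro card_image[symmetric]) (auto intro: inj_on_subset)
      also have "\<dots> \<le> card {Y \<in> F (Suc m). ?R X Y}"
      proof (intro card_mono image_subsetI CollectI)
        fix x assume "x \<in> h ` I - (S \<union> T)"
        then obtain i where "i \<in> I" "x = h i" "h i \<notin> S \<union> T" by blast
        then show "f x \<in> F (Suc m) \<and> ?R X (f x)" using that(6)[of i] by simp
      qed (use finF in simp)
      finally show ?thesis .
    qed
    \<comment> \<open>For even \<open>m\<close> the next step goes from \<open>P\<close> to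
      \<open>Q\<close> and its label joins \<open>S\<close>; for odd \<open>m\<close> it goes back
      and the label joins \<open>T\<close>.\<close>
    show "d - m \<le> card {Y \<in> F (Suc m). ?R X Y}"
    proof (cases "even m")
      case True
      then have vP: "v \<in> P" using v by (simp add: V_def)
      show ?thesis
      proof (rule main[where I = "{q \<in> Q. q \<otimes> inv v \<in> L}" and h = "\<lambda>q. q \<otimes> inv v" and f = "\<lambda>x. (insert x S, T)"])
        fix q assume q: "q \<in> {q \<in> Q. q \<otimes> inv v \<in> L}" "q \<otimes> inv v \<notin> S \<union> T"
        define x where "x = q \<otimes> inv v"
        have x: "x \<in> L" "x \<notin> S \<union> T" "x \<in> carrier G" "q \<in> carrier G" "q \<in> Q"
          using q L(2) Q by (auto simp: x_def)
        have "s \<otimes> (prd (insert x S) \<otimes> inv (prd T)) = x \<otimes> v"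
          using x s by (simp add: prd_insert v_def m_ac)
        also have "\<dots> = q" using x v by (simp add: x_def m_assoc)
        finally show "(insert (q \<otimes> inv v) S, T) \<in> F (Suc m) \<and> ?R X (insert (q \<otimes> inv v) S, T)"
          using x X True unfolding x_def[symmetric] by (auto simp: F_def V_def)
      qed (use Q degP[OF vP] v in \<open>auto intro!: inj_onI simp: subset_iff\<close>)
    next
      case False
      then have vQ: "v \<in> Q" using v by (simp add: V_def)
      show ?thesis
      proof (rule main[where I = "{p \<in> P. v \<otimes> inv p \<in> L}" and h = "\<lambda>p. v \<otimes> inv p" and f = "\<lambda>x. (S, insert x T)"])
        fix p assume p: "p \<in> {p \<in> P. v \<otimes> inv p \<in> L}" "v \<otimes> inv p \<notin> S \<union> T"
        define x where "x = v \<otimes> inv p"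
        have x: "x \<in> L" "x \<notin> S \<union> T" "x \<in> carrier G" "p \<in> carrier G" "p \<in> P"
          using p L(2) P by (auto simp: x_def)
        have "s \<otimes> (prd S \<otimes> inv (prd (insert x T))) = inv x \<otimes> v"
          using x s by (simp add: prd_insert v_def m_ac inv_mult)
        also have "\<dots> = p" using x v by (simp add: x_def inv_mult m_assoc m_comm[of "inv v"])
        finally show "(S, insert (v \<otimes> inv p) T) \<in> F (Suc m) \<and> ?R X (S, insert (v \<otimes> inv p) T)"
          using x X False unfolding x_def[symmetric] by (auto simp: F_def V_def)
      next
        show "inj_on (\<lambda>p. v \<otimes> inv p) {p \<in> P. v \<otimes> inv p \<in> L}"
        proof (rule inj_onI)
          fix p p' assume "p \<in> {p \<in> P. v \<otimes> inv p \<in> L}" "p' \<in> {p \<in> P. v \<otimes> inv p \<in> L}"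
            and eq: "v \<otimes> inv p = v \<otimes> inv p'"
          then have car: "p \<in> carrier G" "p' \<in> carrier G" using P(2) by auto
          then have "inv p = inv p'" using eq v by simp
          then show "p = p'" by (rule inj_onD[OF inv_inj]) (rule car)+
        qed
      qed (use P degQ[OF vQ] v in \<open>auto intro!: inj_onI simp: subset_iff\<close>)
    qed
  qed
  have "d choose m \<le> card (F m)" if "m \<le> d" for m
    using that
  proof (induction m)
    case 0
    have "({}, {}) \<in> F 0" using s by (simp add: F_def V_def)
    then show ?case using finF[of 0] by (auto simp: Suc_le_eq card_gt_0_iff)
  next
    case (Suc m)
    \<comment> \<open>Binomial coefficients satisfy with equality the recursion that
      \<open>step\<close> gives as an inequality.\<close>
    have "Suc m * (d choose Suc m) = (d - m) * (d choose m)"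
      using Suc.prems binomial_absorb_comp[of d m] Suc_times_binomial[of m "d - 1"] by simp
    also have "\<dots> \<le> (d - m) * card (F m)" using Suc by (intro mult_left_mono) auto
    also have "\<dots> \<le> Suc m * card (F (Suc m))" by (rule step)
    finally show ?case by (simp del: mult_Suc)
  qed
  from this[OF m] upper show ?thesis by (rule order.trans)
qed

text \<open>Summing \<open>pop\<close> over \<open>L\<close> counts the edges and yields a subgraph
  whose degrees are at least some \<open>d \<ge> \<delta> * card L\<close>. With
  \<open>m = d div 4\<close> positive, \<open>d choose m \<ge> (d / m) ^ m \<ge> 4 ^ m\<close>;
  compared with the bound \<open>2 ^ m * N\<close> this forces \<open>2 ^ m \<le> N\<close>.\<close>

lemma dissociated_card_le:
  fixes \<delta> :: real
  assumes L: "finite L" "L \<subseteq> carrier G" "dissociated G L"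
    and P: "finite P" "P \<subseteq> carrier G" "P \<noteq> {}" and Q: "finite Q" "Q \<subseteq> carrier G"
    and N: "card P \<le> N" "card Q \<le> N" and "0 < \<delta>"
    and pop: "\<And>x. x \<in> L \<Longrightarrow> \<delta> * real (card P + card Q) \<le> real (card {p \<in> P. p \<otimes> x \<in> Q})"
  shows "\<delta> * real (card L) \<le> 4 * (log 2 (real N) + 1)"
proof (cases "L = {}")
  case True
  have "0 < card P" using P by (simp add: card_gt_0_iff)
  then have "1 \<le> N" using N(1) by simp
  then show ?thesis using True by simp
next
  case False
  define n where "n = real (card L)"
  have n: "0 < n" using False L by (simp add: n_def card_gt_0_iff)
  \<comment> \<open>The largest integer strictly below \<open>\<delta> * n\<close>: the edge bound
    must be strict, and degrees above \<open>k\<close> are then at least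
    \<open>\<delta> * n\<close>.\<close>
  define k where "k = nat (\<lceil>\<delta> * n\<rceil> - 1)"
  have k: "real k < \<delta> * n" "\<delta> * n \<le> real k + 1"
    using mult_pos_pos[OF \<open>0 < \<delta>\<close> n] unfolding k_def by linarith+
  define E where "E = {(p, q) \<in> P \<times> Q. q \<otimes> inv p \<in> L}"
  have finE: "finite E"
    by (rule finite_subset[of _ "P \<times> Q"]) (use P Q in \<open>auto simp: E_def\<close>)
  have "real k * real (card P + card Q) < \<delta> * n * real (card P + card Q)"
  proof (rule mult_strict_right_mono)
    show "0 < real (card P + card Q)" using P card_gt_0_iff[of P] by linarith
  qed (rule k)
  also have "\<dots> = (\<Sum>x\<in>L. \<delta> * real (card P + card Q))"
    by (simp add: n_def)
  also have "\<dots> \<le> (\<Sum>x\<in>L. real (card {p \<in> P. p \<otimes> x \<in> Q}))"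
    by (intro sum_mono pop)
  also have "\<dots> = real (card (SIGMA x:L. {p \<in> P. p \<otimes> x \<in> Q}))"
    using L P by simp
  also have "\<dots> \<le> real (card E)"
  proof -
    let ?f = "\<lambda>(x, p). (p, p \<otimes> x)"
    have "inj_on ?f (SIGMA x:L. {p \<in> P. p \<otimes> x \<in> Q})"
      using L P by (auto intro!: inj_onI simp: subset_iff)
    moreover have "p \<otimes> x \<otimes> inv p = x" if "x \<in> L" "p \<in> P" for x p
    proof -
      have "x \<in> carrier G" "p \<in> carrier G" using that L P by auto
      then show ?thesis by (metis inv_solve_right m_closed m_comm)
    qed
    then have "?f ` (SIGMA x:L. {p \<in> P. p \<otimes> x \<in> Q}) \<subseteq> E"
      using L P by (auto simp: E_def)
    ultimately show ?thesis using finE by (simp add: card_inj_on_le)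
  qed
  finally have "k * (card P + card Q) < card E" by (metis of_nat_less_iff of_nat_mult)
  then obtain P' Q' where PQ: "P' \<subseteq> P" "Q' \<subseteq> Q" "P' \<noteq> {}"
    "\<And>p. p \<in> P' \<Longrightarrow> k < card {q \<in> Q'. q \<otimes> inv p \<in> L}"
    "\<And>q. q \<in> Q' \<Longrightarrow> k < card {p \<in> P'. q \<otimes> inv p \<in> L}"
    unfolding E_def by (rule min_degree_subgraph[OF P(1) Q(1)]) blast
  define m where "m = Suc k div 4"
  have "Suc k choose m \<le> 2 ^ m * N"
  proof (rule binomial_le_min_degree[OF L])
    show "finite P'" "finite Q'" "card P' \<le> N" "card Q' \<le> N"
      using PQ P Q N by (meson finite_subset card_mono order.trans)+
    show "m \<le> Suc k" by (simp add: m_def)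
  qed (use PQ P Q in \<open>auto simp: Suc_le_eq\<close>)
  then have "real (Suc k choose m) \<le> real (2 ^ m * N)"
    by (rule of_nat_mono)
  then have "real (Suc k choose m) \<le> 2 ^ m * real N"
    by simp
  moreover have "4 ^ m \<le> real (Suc k choose m)"
  proof (cases "m = 0")
    case False
    have "4 * m \<le> Suc k" by (simp add: m_def)
    then have "4 * real m \<le> real (Suc k)" by (metis of_nat_le_iff of_nat_mult of_nat_numeral)
    then have "4 \<le> real (Suc k) / real m" using False by (simp add: field_simps)
    then have "4 ^ m \<le> (real (Suc k) / real m) ^ m" by (intro power_mono) auto
    also have "\<dots> \<le> real (Suc k choose m)"
      by (rule binomial_ge_n_over_k_pow_k) (simp add: m_def)
    finally show ?thesis .
  qed simp
  moreover have "(4::real) ^ m = 2 ^ m * 2 ^ m" by (simp flip: power_mult_distrib)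
  ultimately have "2 ^ m * 2 ^ m \<le> 2 ^ m * real N" by linarith
  then have "2 ^ m \<le> real N" by (rule mult_left_le_imp_le) simp
  then have "real m \<le> log 2 (real N)"
    by (intro le_log_of_power) auto
  \<comment> \<open>The summand 1 in the claim absorbs the rounding in the division by four.\<close>
  moreover have "real k + 1 \<le> 4 * real m + 4" unfolding m_def by linarith
  ultimately have "real k + 1 \<le> 4 * (log 2 (real N) + 1)" by simp
  with k(2) show ?thesis unfolding n_def by (rule order.trans)
qed


section \<open>Sets of small doubling\<close>

lemma set_mult_image: "A <#> B = (\<lambda>(a, b). a \<otimes> b) ` (A \<times> B)"
  by (auto simp: set_mult_def)

lemma finite_set_mult: "finite A \<Longrightarrow> finite B \<Longrightarrow> finite (A <#> B)"
  by (simp add: set_mult_image)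

lemma card_set_mult_le:
  assumes "finite A" "finite B"
  shows "card (A <#> B) \<le> card A * card B"
  using card_image_le[of "A \<times> B" "\<lambda>(a, b). a \<otimes> b"] assms by (simp add: set_mult_image)

lemma card_le_set_mult:
  assumes "finite A" "finite B" "A \<subseteq> carrier G" "B \<subseteq> carrier G" "A \<noteq> {}"
  shows "card B \<le> card (A <#> B)"
proof -
  obtain a where a: "a \<in> A" "a \<in> carrier G" using assms by auto
  have "inj_on ((\<otimes>) a) B" using a assms(4) by (auto intro!: inj_onI simp: subset_iff)
  moreover have "(\<otimes>) a ` B \<subseteq> A <#> B" using a by (auto simp: set_mult_def)
  ultimately show ?thesis using assms by (meson card_inj_on_le finite_set_mult)
qed

text \<open>An instance of the Ruzsa triangle inequality. Fix a representation of each quotient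
  \<open>d\<close> by a pair \<open>p d\<close>; multiplying both entries by \<open>a\<close> keeps
  their quotient \<open>d\<close>, so the resulting pair of products determines \<open>d\<close> and
  then \<open>a\<close>.\<close>

lemma Ruzsa_card_quotients_le:
  assumes "finite A" "A \<subseteq> carrier G"
  shows "card ((\<lambda>(a, b). a \<otimes> inv b) ` (A \<times> A)) * card A \<le> (card (A <#> A))\<^sup>2"
proof -
  define D where "D = (\<lambda>(a, b). a \<otimes> inv b) ` (A \<times> A)"
  have "\<forall>d\<in>D. \<exists>p. fst p \<in> A \<and> snd p \<in> A \<and> d = fst p \<otimes> inv (snd p)"
    by (force simp: D_def)
  then obtain p where p: "\<And>d. d \<in> D \<Longrightarrow> fst (p d) \<in> A \<and> snd (p d) \<in> A \<and> d = fst (p d) \<otimes> inv (snd (p d))"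
    by metis
  define f where "f = (\<lambda>(d, a). (fst (p d) \<otimes> a, snd (p d) \<otimes> a))"
  have "inj_on f (D \<times> A)"
  proof (rule inj_onI, clarify)
    fix d a d' a' assume d: "d \<in> D" "d' \<in> D" and a: "a \<in> A" "a' \<in> A"
      and "f (d, a) = f (d', a')"
    then have eq: "fst (p d) \<otimes> a = fst (p d') \<otimes> a'" "snd (p d) \<otimes> a = snd (p d') \<otimes> a'"
      by (simp_all add: f_def)
    have quot: "e = (fst (p e) \<otimes> b) \<otimes> inv (snd (p e) \<otimes> b)" if "e \<in> D" "b \<in> A" for e b
    proof -
      have "fst (p e) \<in> carrier G" "snd (p e) \<in> carrier G" "b \<in> carrier G"
        using p[OF that(1)] that assms(2) by auto
      then have "(fst (p e) \<otimes> b) \<otimes> inv (snd (p e) \<otimes> b) = fst (p e) \<otimes> inv (snd (p e))"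
        by (simp add: inv_mult m_ac) (simp add: m_assoc[symmetric])
      then show ?thesis using p[OF that(1)] by metis
    qed
    have "d = d'" using quot[OF d(1) a(1)] quot[OF d(2) a(2)] eq by simp
    moreover have "a = a'" using eq(1) p[OF d(2)] a assms(2) \<open>d = d'\<close> by (simp add: subset_iff)
    ultimately show "d = d' \<and> a = a'" by simp
  qed
  moreover have "f ` (D \<times> A) \<subseteq> (A <#> A) \<times> (A <#> A)"
    using p by (auto simp: f_def set_mult_def)
  ultimately have "card (D \<times> A) \<le> card ((A <#> A) \<times> (A <#> A))"
    using assms(1) by (meson card_inj_on_le finite_SigmaI finite_set_mult)
  then show ?thesis
    unfolding D_def[symmetric] by (simp only: card_cartesian_product power2_eq_square)
qed

section \<open>Popular differences and the density iteration\<close>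

text \<open>
  The Katz--Koester observation: if \<open>X' = {y \<in> X. t \<otimes> y \<in> X}\<close> and \<open>S = X <#> A\<close>, then
  \<open>X' <#> A\<close> lies in \<open>{s \<in> S. t \<otimes> s \<in> S}\<close>.
\<close>

lemma popular_or_shrink:
  fixes M \<kappa> :: real
  assumes X: "finite X" "X \<subseteq> carrier G" and A: "finite A" "A \<subseteq> carrier G"
    and M: "0 < M" "real (card ((\<lambda>(a, b). a \<otimes> inv b) ` (X \<times> X))) \<le> M"
    and "X \<noteq> {}"
  obtains
    (popular) y X' where "y \<in> X" "X' \<subseteq> X" "card X \<le> 2 * card X'"
      "\<And>x. x \<in> X' \<Longrightarrow>
        \<kappa> * real (card (X <#> A)) \<le> real (card {s \<in> X <#> A. x \<otimes> inv y \<otimes> s \<in> X <#> A})"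
  | (shrink) X' where "X' \<subseteq> X" "(real (card X))\<^sup>2 \<le> 2 * M * real (card X')"
      "real (card (X' <#> A)) \<le> \<kappa> * real (card (X <#> A))"
proof -
  define S where "S = X <#> A"
  have finS: "finite S" using X A by (simp add: S_def finite_set_mult)
  define r where "r = (\<lambda>t. card {y \<in> X. t \<otimes> y \<in> X})"
  define D where "D = (\<lambda>(a, b). a \<otimes> inv b) ` (X \<times> X)"
  have finD: "finite D" using X by (simp add: D_def)
  \<comment> \<open>\<open>r t\<close> counts the representations of \<open>t\<close> as a quotient
    of elements of \<open>X\<close>. There are at most \<open>M\<close> quotients, so those with
    fewer than \<open>\<tau>\<close> representations account for at most \<open>M * \<tau>\<close>
    pairs, half of \<open>X \<times> X\<close>.\<close>
  define \<tau> where "\<tau> = (real (card X))\<^sup>2 / (2 * M)"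
  show ?thesis
  proof (cases "\<exists>t\<in>D. \<tau> \<le> real (r t) \<and> real (card {s \<in> S. t \<otimes> s \<in> S}) < \<kappa> * real (card S)")
    case True
    then obtain t where t: "t \<in> D" "\<tau> \<le> real (r t)"
      "real (card {s \<in> S. t \<otimes> s \<in> S}) < \<kappa> * real (card S)" by blast
    have tG: "t \<in> carrier G" using t(1) X by (auto simp: D_def)
    let ?X' = "{y \<in> X. t \<otimes> y \<in> X}"
    have "t \<otimes> (y \<otimes> a) \<in> S" if "y \<in> X" "t \<otimes> y \<in> X" "a \<in> A" for y a
    proof -
      have "y \<in> carrier G" "a \<in> carrier G" using that X A by auto
      then have "t \<otimes> (y \<otimes> a) = (t \<otimes> y) \<otimes> a" using tG by (simp add: m_assoc)
      then show ?thesis using that by (auto simp: S_def set_mult_def)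
    qed
    then have "?X' <#> A \<subseteq> {s \<in> S. t \<otimes> s \<in> S}"
      by (auto simp: S_def set_mult_def)
    then have "card (?X' <#> A) \<le> card {s \<in> S. t \<otimes> s \<in> S}"
      using finS by (intro card_mono) auto
    then have "real (card (?X' <#> A)) \<le> \<kappa> * real (card S)"
      using t(3) by linarith
    moreover have "(real (card X))\<^sup>2 \<le> 2 * M * real (card ?X')"
      using t(2) M(1) unfolding r_def \<tau>_def by (simp add: field_simps)
    ultimately show ?thesis using shrink[of ?X'] by (auto simp: S_def)
  next
    case False
    then have pop: "\<kappa> * real (card S) \<le> real (card {s \<in> S. t \<otimes> s \<in> S})"
      if "t \<in> D" "\<tau> \<le> real (r t)" for t
      using that by force
    define B where "B = {t \<in> D. real (r t) < \<tau>}"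
    define good where "good = (\<lambda>y. {x \<in> X. \<tau> \<le> real (r (x \<otimes> inv y))})"
    have finB: "finite B" using finD by (simp add: B_def)
    \<comment> \<open>A pair with unpopular quotient \<open>t\<close> is determined by
      \<open>t\<close> and \<open>y\<close>, which leaves \<open>r t\<close> pairs for each
      \<open>t\<close>.\<close>
    have "{(x, y). x \<in> X \<and> y \<in> X \<and> real (r (x \<otimes> inv y)) < \<tau>}
        \<subseteq> (\<Union>t\<in>B. (\<lambda>y. (t \<otimes> y, y)) ` {y \<in> X. t \<otimes> y \<in> X})"
    proof clarify
      fix x y assume xy: "x \<in> X" "y \<in> X" "real (r (x \<otimes> inv y)) < \<tau>"
      define t where "t = x \<otimes> inv y"
      have "t \<otimes> y = x" using xy X by (auto simp: t_def m_assoc subset_iff)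
      moreover have "t \<in> B" using xy by (auto simp: B_def D_def t_def)
      ultimately show "(x, y) \<in> (\<Union>t\<in>B. (\<lambda>y. (t \<otimes> y, y)) ` {y \<in> X. t \<otimes> y \<in> X})"
        using xy by force
    qed
    then have "card {(x, y). x \<in> X \<and> y \<in> X \<and> real (r (x \<otimes> inv y)) < \<tau>}
        \<le> card (\<Union>t\<in>B. (\<lambda>y. (t \<otimes> y, y)) ` {y \<in> X. t \<otimes> y \<in> X})"
      using finB X by (intro card_mono) auto
    also have "\<dots> \<le> (\<Sum>t\<in>B. card ((\<lambda>y. (t \<otimes> y, y)) ` {y \<in> X. t \<otimes> y \<in> X}))"
      using finB by (rule card_UN_le)
    also have "\<dots> = (\<Sum>t\<in>B. r t)"
      by (rule sum.cong) (auto simp: r_def card_image inj_on_def)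
    finally have "real (card {(x, y). x \<in> X \<and> y \<in> X \<and> real (r (x \<otimes> inv y)) < \<tau>}) \<le> real (\<Sum>t\<in>B. r t)"
      by (rule of_nat_mono)
    also have "\<dots> \<le> real (card B) * \<tau>"
      using sum_bounded_above[of B "\<lambda>t. real (r t)" \<tau>] by (auto simp: B_def)
    also have "\<dots> \<le> M * \<tau>"
    proof (rule mult_right_mono)
      have "card B \<le> card D" using finD by (auto simp: B_def intro!: card_mono)
      then show "real (card B) \<le> M" using M(2) unfolding D_def by linarith
    qed (use M(1) in \<open>simp add: \<tau>_def\<close>)
    also have "\<dots> = (real (card X))\<^sup>2 / 2" using M(1) by (simp add: \<tau>_def)
    finally have few: "real (card {(x, y). x \<in> X \<and> y \<in> X \<and> real (r (x \<otimes> inv y)) < \<tau>})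
      \<le> (real (card X))\<^sup>2 / 2" .
    \<comment> \<open>Averaging: at least half of all pairs have a popular quotient, so some
      \<open>y\<close> is paired in this way with at least half of \<open>X\<close>.\<close>
    have "\<exists>y\<in>X. card X \<le> 2 * card (good y)"
    proof (rule ccontr)
      assume "\<not> ?thesis"
      then have "real (card (good y)) < real (card X) / 2" if "y \<in> X" for y
        using that by force
      then have "(\<Sum>y\<in>X. real (card (good y))) < (\<Sum>y\<in>X. real (card X) / 2)"
        using X \<open>X \<noteq> {}\<close> by (intro sum_strict_mono) auto
      then have "real (\<Sum>y\<in>X. card (good y)) < (real (card X))\<^sup>2 / 2"
        by (simp add: power2_eq_square)
      moreover have "card (X \<times> X) \<le> card {(x, y). x \<in> X \<and> y \<in> X \<and> real (r (x \<otimes> inv y)) < \<tau>}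
          + (\<Sum>y\<in>X. card (good y))"
      proof -
        have "X \<times> X = {(x, y). x \<in> X \<and> y \<in> X \<and> real (r (x \<otimes> inv y)) < \<tau>}
            \<union> (\<Union>y\<in>X. (\<lambda>x. (x, y)) ` good y)"
          by (auto simp: good_def)
        then have "card (X \<times> X) \<le> card {(x, y). x \<in> X \<and> y \<in> X \<and> real (r (x \<otimes> inv y)) < \<tau>}
            + card (\<Union>y\<in>X. (\<lambda>x. (x, y)) ` good y)"
          by (metis (no_types, lifting) card_Un_le)
        also have "card (\<Union>y\<in>X. (\<lambda>x. (x, y)) ` good y) \<le> (\<Sum>y\<in>X. card ((\<lambda>x. (x, y)) ` good y))"
          using X by (intro card_UN_le)
        also have "\<dots> = (\<Sum>y\<in>X. card (good y))"
          by (rule sum.cong) (auto simp: card_image inj_on_def)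
        finally show ?thesis by simp
      qed
      then have "real (card (X \<times> X)) \<le> real (card {(x, y). x \<in> X \<and> y \<in> X \<and> real (r (x \<otimes> inv y)) < \<tau>}
          + (\<Sum>y\<in>X. card (good y)))"
        by (rule of_nat_mono)
      moreover have "real (card (X \<times> X)) = (real (card X))\<^sup>2"
        by (simp add: power2_eq_square card_cartesian_product)
      ultimately show False using few unfolding of_nat_add by linarith
    qed
    then obtain y where y: "y \<in> X" "card X \<le> 2 * card (good y)" by blast
    have "\<kappa> * real (card (X <#> A)) \<le> real (card {s \<in> X <#> A. x \<otimes> inv y \<otimes> s \<in> X <#> A})"
      if "x \<in> good y" for x
    proof -
      have "x \<otimes> inv y \<in> D" using that y by (auto simp: good_def D_def)
      then show ?thesis using pop[of "x \<otimes> inv y"] that unfolding S_def by (simp add: good_def)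
    qed
    moreover have "good y \<subseteq> X" by (auto simp: good_def)
    ultimately show ?thesis using popular[of y "good y"] y by blast
  qed
qed

text \<open>A maximal dissociated subset of \<open>X\<close> spans \<open>X\<close> and is small by
  \<open>dissociated_card_le\<close>. Bounding the sizes by \<open>n\<^sup>2\<close>, as is natural
  for product sets of an \<open>n\<close>-element set, costs only a factor two in the
  logarithm.\<close>

lemma signed_span_of_popular:
  fixes \<delta> :: real
  assumes X: "finite X" "X \<subseteq> carrier G"
    and P: "finite P" "P \<subseteq> carrier G" "P \<noteq> {}" and Q: "finite Q" "Q \<subseteq> carrier G"
    and N: "card P \<le> n\<^sup>2" "card Q \<le> n\<^sup>2" "2 \<le> n" and "0 < \<delta>"
    and pop: "\<And>x. x \<in> X \<Longrightarrow> \<delta> * real (card P + card Q) \<le> real (card {p \<in> P. p \<otimes> x \<in> Q})"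
  obtains L where "L \<subseteq> X" "X \<subseteq> signed_span G L" "\<delta> * real (card L) \<le> 24 * ln (real n)"
proof -
  obtain L where L: "L \<subseteq> X" "dissociated G L" "X \<subseteq> signed_span G L"
    using maximal_dissociated[OF X] .
  have fin: "finite L" "L \<subseteq> carrier G" using L(1) X finite_subset by auto
  have "\<delta> * real (card L) \<le> 4 * (log 2 (real (n\<^sup>2)) + 1)"
    using L(1) pop by (intro dissociated_card_le[OF fin L(2) P Q N(1,2) \<open>0 < \<delta>\<close>]) auto
  also have "log 2 (real (n\<^sup>2)) = 2 * log 2 (real n)"
    using N(3) by (simp add: log_nat_power)
  \<comment> \<open>\<open>2 \<le> n\<close> makes the logarithm at least one, which absorbs the
    summand; 12 becomes 24 below because \<open>ln 2 \<ge> 1 / 2\<close>.\<close>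
  also have "4 * (2 * log 2 (real n) + 1) \<le> 12 * log 2 (real n)"
    using N(3) by simp
  also have "\<dots> = 12 / ln 2 * ln (real n)" by (simp add: log_def)
  also have "\<dots> \<le> 24 * ln (real n)"
  proof (rule mult_right_mono)
    have "1 / 2 \<le> ln (2::real)" using ln_le_minus_one[of "1 / 2 :: real"] by (simp add: ln_div)
    then show "12 / ln 2 \<le> (24::real)" by (simp add: field_simps)
  qed (use N(3) in simp)
  finally show ?thesis using that L by blast
qed


text \<open>
  Each shrinking step gains a factor \<open>K powr -\<eta>\<close> in \<open>card (X <#> A)\<close> and roughly squares the
  density of \<open>X\<close> in \<open>A\<close>, so the density is \<open>K powr - (3 * (2 ^ j - 1))\<close> after \<open>j\<close> steps.
\<close>

lemma popular_subset:
  fixes K \<eta> :: real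
  assumes A: "finite A" "A \<subseteq> carrier G" "A \<noteq> {}" and K: "2 \<le> K"
    and dbl: "real (card (A <#> A)) \<le> K * real (card A)"
  shows "(\<exists>X X' y. X \<subseteq> A \<and> X \<noteq> {} \<and> X' \<subseteq> X \<and> y \<in> carrier G
        \<and> K powr (- 3 * 2 ^ j) * real (card A) \<le> real (card X')
        \<and> (\<forall>x\<in>X'. K powr (-\<eta>) * real (card (X <#> A))
              \<le> real (card {s \<in> X <#> A. x \<otimes> inv y \<otimes> s \<in> X <#> A})))
    \<or> (\<exists>X. X \<subseteq> A \<and> X \<noteq> {} \<and> K powr (- 3 * (2 ^ j - 1)) * real (card A) \<le> real (card X)
        \<and> real (card (X <#> A)) \<le> K powr (1 - real j * \<eta>) * real (card A))"
    (is "?popular j \<or> ?small j")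
proof (induction j)
  case 0
  have "?small 0" using A K dbl by (intro exI[of _ A]) auto
  then show ?case by blast
next
  case (Suc j)
  have a: "0 < real (card A)" using A by (simp add: card_gt_0_iff)
  \<comment> \<open>The popular alternative only weakens as \<open>j\<close> grows, so once reached
    it persists.\<close>
  have mono: "K powr (- 3 * 2 ^ Suc j) \<le> K powr (- 3 * 2 ^ j)"
    using K by (intro powr_mono) auto
  from Suc show ?case
  proof
    assume "?popular j"
    then obtain X X' y where "X \<subseteq> A" "X \<noteq> {}" "X' \<subseteq> X" "y \<in> carrier G"
      "K powr (- 3 * 2 ^ j) * real (card A) \<le> real (card X')"
      "\<forall>x\<in>X'. K powr (-\<eta>) * real (card (X <#> A))
              \<le> real (card {s \<in> X <#> A. x \<otimes> inv y \<otimes> s \<in> X <#> A})" by blast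
    moreover from this mono a have "K powr (- 3 * 2 ^ Suc j) * real (card A) \<le> real (card X')"
      by (meson mult_right_mono order.trans less_imp_le)
    ultimately have "?popular (Suc j)" by blast
    then show ?thesis by blast
  next
    assume "?small j"
    then obtain X where X: "X \<subseteq> A" "X \<noteq> {}"
      and dens: "K powr (- 3 * (2 ^ j - 1)) * real (card A) \<le> real (card X)"
      and small: "real (card (X <#> A)) \<le> K powr (1 - real j * \<eta>) * real (card A)" by blast
    \<comment> \<open>By Ruzsa's inequality \<open>M\<close> bounds the number of quotients of
      \<open>A\<close>, hence of every \<open>X \<subseteq> A\<close>.\<close>
    define M where "M = K\<^sup>2 * real (card A)"
    have finX: "finite X" "X \<subseteq> carrier G" using X A finite_subset by auto
    have M: "0 < M" using a K by (simp add: M_def)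
    have "card ((\<lambda>(a, b). a \<otimes> inv b) ` (X \<times> X)) \<le> card ((\<lambda>(a, b). a \<otimes> inv b) ` (A \<times> A))"
      using X A by (intro card_mono image_mono) auto
    moreover have "real (card ((\<lambda>(a, b). a \<otimes> inv b) ` (A \<times> A))) * real (card A) \<le> M * real (card A)"
    proof -
      have "real (card ((\<lambda>(a, b). a \<otimes> inv b) ` (A \<times> A)) * card A) \<le> real ((card (A <#> A))\<^sup>2)"
        using Ruzsa_card_quotients_le[OF A(1,2)] by (simp only: of_nat_le_iff)
      also have "\<dots> = (real (card (A <#> A)))\<^sup>2" by simp
      also have "\<dots> \<le> (K * real (card A))\<^sup>2" using dbl by (intro power_mono) auto
      finally show ?thesis by (simp add: M_def power2_eq_square mult_ac)
    qed
    then have "real (card ((\<lambda>(a, b). a \<otimes> inv b) ` (A \<times> A))) \<le> M"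
      using a by (metis mult_le_cancel_right_pos)
    ultimately have XM: "real (card ((\<lambda>(a, b). a \<otimes> inv b) ` (X \<times> X))) \<le> M" by linarith
    show ?thesis
    proof (rule popular_or_shrink[OF finX A(1,2) M XM X(2), of "K powr (-\<eta>)"])
      fix y X' assume y: "y \<in> X" "X' \<subseteq> X" "card X \<le> 2 * card X'"
        "\<And>x. x \<in> X' \<Longrightarrow> K powr (-\<eta>) * real (card (X <#> A))
          \<le> real (card {s \<in> X <#> A. x \<otimes> inv y \<otimes> s \<in> X <#> A})"
      \<comment> \<open>One factor \<open>K powr (-1) \<le> 1 / 2\<close> pays for passing to half
        of \<open>X\<close>.\<close>
      have "K powr (- 3 * 2 ^ Suc j) * real (card A) \<le> K powr (-1) * (K powr (- 3 * (2 ^ j - 1)) * real (card A))"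
      proof -
        have "- 3 * 2 ^ Suc j \<le> -1 + (- 3 * (2 ^ j - 1) :: real)"
          using one_le_power[of "2::real" j] by simp
        then have "K powr (- 3 * 2 ^ Suc j) \<le> K powr (-1) * K powr (- 3 * (2 ^ j - 1))"
          using K unfolding powr_add[symmetric] by (intro powr_mono) auto
        then show ?thesis unfolding mult.assoc[symmetric] by (rule mult_right_mono) simp
      qed
      also have "\<dots> \<le> K powr (-1) * real (card X)" using dens by (intro mult_left_mono) auto
      also have "\<dots> \<le> 1 / 2 * real (card X)"
        using K by (intro mult_right_mono) (auto simp: powr_minus field_simps)
      also have "\<dots> \<le> real (card X')" using y(3) by simp
      finally have "?popular (Suc j)" using y X finX by blast
      then show ?thesis by blast
    next
      fix X' assume X': "X' \<subseteq> X" "(real (card X))\<^sup>2 \<le> 2 * M * real (card X')"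
        "real (card (X' <#> A)) \<le> K powr (-\<eta>) * real (card (X <#> A))"
      have "X' \<noteq> {}"
      proof
        assume "X' = {}"
        then have "real (card X) = 0" using X'(2) by simp
        then show False using finX X by simp
      qed
      moreover have "real (card (X' <#> A)) \<le> K powr (1 - real (Suc j) * \<eta>) * real (card A)"
      proof -
        have "real (card (X' <#> A)) \<le> K powr (-\<eta>) * (K powr (1 - real j * \<eta>) * real (card A))"
          using X'(3) small by (meson mult_left_mono order.trans powr_ge_zero)
        also have "\<dots> = K powr (1 - real (Suc j) * \<eta>) * real (card A)"
          using K by (simp add: mult.assoc[symmetric] powr_add[symmetric] algebra_simps)
        finally show ?thesis .
      qed
      moreover have "K powr (- 3 * (2 ^ Suc j - 1)) * real (card A) \<le> real (card X')"
      proof -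
        \<comment> \<open>The loss \<open>2 * K\<^sup>2\<close> is at most \<open>K powr 3\<close>,
          so the density exponent \<open>e = 3 * (2 ^ j - 1)\<close> becomes
          \<open>2 * e + 3 = 3 * (2 ^ Suc j - 1)\<close>.\<close>
        have K3: "2 * K\<^sup>2 \<le> K powr 3"
          using K by (simp add: powr_numeral power3_eq_cube power2_eq_square)
        have "(K powr (- 3 * (2 ^ j - 1)) * real (card A))\<^sup>2 \<le> (real (card X))\<^sup>2"
          using dens by (intro power_mono) auto
        also have "\<dots> \<le> 2 * K\<^sup>2 * real (card A) * real (card X')"
          using X'(2) by (simp add: M_def mult_ac)
        also have "\<dots> \<le> K powr 3 * real (card A) * real (card X')"
          using K3 by (intro mult_right_mono) auto
        finally have "(K powr (- 3 * (2 ^ j - 1)))\<^sup>2 * real (card A) \<le> K powr 3 * real (card X')"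
          using a by (simp add: power2_eq_square mult_ac)
        then have "K powr (-3) * ((K powr (- 3 * (2 ^ j - 1)))\<^sup>2 * real (card A))
            \<le> K powr (-3) * (K powr 3 * real (card X'))"
          by (intro mult_left_mono) auto
        also have "\<dots> = real (card X')"
          unfolding mult.assoc[symmetric] powr_add[symmetric] using K by simp
        also have "K powr (-3) * ((K powr (- 3 * (2 ^ j - 1)))\<^sup>2 * real (card A))
            = K powr (- 3 * (2 ^ Suc j - 1)) * real (card A)"
          by (simp add: power2_eq_square mult.assoc[symmetric] powr_add[symmetric] algebra_simps)
        finally show ?thesis .
      qed
      ultimately have "?small (Suc j)" using X X'(1) by blast
      then show ?thesis by blast
    qed
  qed
qed

text \<open>Combines \<open>popular_subset\<close> with \<open>signed_span_of_popular\<close>. The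
  constant 72 is \<open>3 * 24\<close> from the case \<open>K < 2\<close>; the other case gives
  \<open>2 * 24\<close> and the exponent \<open>3 * 2 ^ j\<close> with \<open>j\<close> about
  \<open>1 / \<eta>\<close>.\<close>

lemma large_intersection_with_span:
  fixes K \<eta> :: real
  assumes A: "A \<subseteq> carrier G" "finite A" "card A \<noteq> 1"
    and dbl: "real (card (A <#> A)) \<le> K * real (card A)" and \<eta>: "0 < \<eta>"
  shows "\<exists>L. L \<subseteq> carrier G \<and> finite L
    \<and> K powr (- (72 * exp (72 / \<eta>))) * real (card A) \<le> real (card (A \<inter> signed_span G L))
    \<and> real (card L) \<le> 72 * (K powr \<eta> * ln (real (card A)))"
proof (cases "A = {}")
  \<comment> \<open>Both bounds reduce to \<open>0 \<le> 0\<close>, by the default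
    \<open>ln 0 = 0\<close>.\<close>
  case True
  then show ?thesis by (intro exI[of _ "{}"]) auto
next
  case False
  define E where "E = 72 * exp (72 / \<eta>)"
  have "0 < card A" using A False by (simp add: card_gt_0_iff)
  then have A2: "2 \<le> card A" using A by linarith
  then have lnA: "0 < ln (real (card A))" by simp
  have finAA: "finite (A <#> A)" using A by (simp add: finite_set_mult)
  have cAA: "card (A <#> A) \<le> (card A)\<^sup>2"
    using card_set_mult_le[OF A(2,2)] by (simp add: power2_eq_square)
  have "real (card A) \<le> K * real (card A)"
    using card_le_set_mult[OF A(2,2,1,1) False] dbl by linarith
  then have K1: "1 \<le> K" using A2 by simp
  \<comment> \<open>The iteration absorbs factors of two into powers of \<open>K\<close>, so
    \<open>K < 2\<close> is treated apart: every \<open>p\<close> in \<open>A\<close> sends every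
    \<open>x\<close> in \<open>A\<close> into \<open>A <#> A\<close>, and the two sets have total
    size at most \<open>3 * card A\<close>, whence \<open>\<delta> = 1 / 3\<close>.\<close>
  show ?thesis
  proof (cases "K < 2")
    case True
    obtain L where L: "L \<subseteq> A" "A \<subseteq> signed_span G L" "1 / 3 * real (card L) \<le> 24 * ln (real (card A))"
    proof (rule signed_span_of_popular[where X = A and P = A and Q = "A <#> A" and n = "card A" and \<delta> = "1 / 3 :: real"])
      fix x assume x: "x \<in> A"
      have "{p \<in> A. p \<otimes> x \<in> A <#> A} = A" using x by (auto simp: set_mult_def)
      moreover have "real (card (A <#> A)) \<le> 2 * real (card A)"
        using dbl mult_right_mono[of K 2 "real (card A)"] True by simp
      ultimately show "1 / 3 * real (card A + card (A <#> A)) \<le> real (card {p \<in> A. p \<otimes> x \<in> A <#> A})"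
        by simp
    qed (use A A2 False finAA cAA in \<open>auto simp: set_mult_closed power2_eq_square\<close>)
    have "A \<inter> signed_span G L = A" using L(2) by auto
    moreover have "K powr (- E) \<le> 1"
      using K1 powr_mono[of "-E" 0 K] by (simp add: E_def)
    then have "K powr (- E) * real (card A) \<le> real (card A)"
      by (simp add: mult_left_le_one_le)
    moreover have "ln (real (card A)) \<le> K powr \<eta> * ln (real (card A))"
      using K1 \<eta> lnA by (simp add: ge_one_powr_ge_zero)
    then have "real (card L) \<le> 72 * (K powr \<eta> * ln (real (card A)))" using L(3) by linarith
    ultimately show ?thesis using L(1) A finite_subset unfolding E_def by (metis subset_trans)
  next
    case False
    then have K: "2 \<le> K" by simp
    \<comment> \<open>The least integer exceeding \<open>1 / \<eta>\<close>, so that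
      \<open>1 - j * \<eta>\<close> is negative.\<close>
    define j where "j = Suc (nat \<lfloor>1 / \<eta>\<rfloor>)"
    have j: "1 / \<eta> < real j" using \<eta> unfolding j_def by linarith
    have "real j \<le> 1 / \<eta> + 1" using \<eta> unfolding j_def by simp
    have "(2::real) ^ j \<le> exp 1 ^ j"
      using exp_ge_add_one_self[of "1::real"] by (intro power_mono) auto
    also have "\<dots> = exp (real j)" by (simp add: exp_of_nat_mult[symmetric])
    also have "\<dots> \<le> exp (1 / \<eta> + 1)" using \<open>real j \<le> 1 / \<eta> + 1\<close> by simp
    also have "\<dots> = exp (1 / \<eta>) * exp 1" by (simp add: exp_add)
    also have "\<dots> \<le> exp (1 / \<eta>) * 3" using exp_le by (intro mult_left_mono) auto
    also have "\<dots> \<le> exp (72 / \<eta>) * 3" using \<eta> by (simp add: divide_right_mono)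
    finally have jE: "3 * 2 ^ j \<le> E" unfolding E_def using exp_gt_zero[of "72 / \<eta>"] by linarith
    \<comment> \<open>After \<open>j\<close> shrinking steps \<open>X <#> A\<close> would be smaller
      than \<open>A\<close>, which is impossible for nonempty \<open>X\<close>.\<close>
    have not_small: "\<not> (\<exists>X. X \<subseteq> A \<and> X \<noteq> {}
        \<and> K powr (- 3 * (2 ^ j - 1)) * real (card A) \<le> real (card X)
        \<and> real (card (X <#> A)) \<le> K powr (1 - real j * \<eta>) * real (card A))"
    proof clarify
      fix X assume X: "X \<subseteq> A" "X \<noteq> {}"
        and small: "real (card (X <#> A)) \<le> K powr (1 - real j * \<eta>) * real (card A)"
      have "finite X" "X \<subseteq> carrier G" using X A finite_subset by auto
      then have "card A \<le> card (X <#> A)" using card_le_set_mult X A by blast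
      moreover have "1 - real j * \<eta> < 0" using j \<eta> by (simp add: field_simps)
      then have "K powr (1 - real j * \<eta>) < 1" using K powr_less_mono[of "1 - real j * \<eta>" 0 K] by simp
      then have "K powr (1 - real j * \<eta>) * real (card A) < 1 * real (card A)"
        using A2 by (intro mult_strict_right_mono) auto
      ultimately show False using small by linarith
    qed
    then obtain X X' y where X: "X \<subseteq> A" "X \<noteq> {}" "X' \<subseteq> X" "y \<in> carrier G"
      and dens: "K powr (- 3 * 2 ^ j) * real (card A) \<le> real (card X')"
      and pop: "\<And>x. x \<in> X' \<Longrightarrow> K powr (-\<eta>) * real (card (X <#> A))
              \<le> real (card {s \<in> X <#> A. x \<otimes> inv y \<otimes> s \<in> X <#> A})"
      using popular_subset[OF A(2,1) \<open>A \<noteq> {}\<close> K dbl, of j \<eta>] by blast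
    define S where "S = X <#> A"
    have finX: "finite X" using X A finite_subset by blast
    have S: "finite S" "S \<subseteq> carrier G" "S \<noteq> {}"
      using finX X A \<open>A \<noteq> {}\<close> unfolding S_def
      by (auto simp: finite_set_mult set_mult_image subset_iff)
    have "S \<subseteq> A <#> A" using X by (auto simp: S_def set_mult_image)
    then have cS: "card S \<le> (card A)\<^sup>2" using finAA cAA card_mono order.trans by blast
    \<comment> \<open>Translating by \<open>inv y\<close> turns the popularity of
      \<open>x \<otimes> inv y\<close> for \<open>S\<close> into that of \<open>x\<close> between
      \<open>P\<close> and \<open>S\<close>.\<close>
    define P where "P = (\<lambda>s. inv y \<otimes> s) ` S"
    have injP: "inj_on (\<lambda>s. inv y \<otimes> s) S"
      using S X(4) by (auto intro!: inj_onI simp: subset_iff)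
    then have cP: "card P = card S" by (simp add: P_def card_image)
    obtain L where L: "L \<subseteq> X'" "X' \<subseteq> signed_span G L"
      "K powr (-\<eta>) / 2 * real (card L) \<le> 24 * ln (real (card A))"
    proof (rule signed_span_of_popular[where X = X' and P = P and Q = S and n = "card A" and \<delta> = "K powr (-\<eta>) / 2"])
      fix x assume x: "x \<in> X'"
      have xG: "x \<in> carrier G" using x X A by auto
      have "(inv y \<otimes> s) \<otimes> x = x \<otimes> inv y \<otimes> s" if "s \<in> S" for s
      proof -
        have "s \<in> carrier G" using that S by auto
        then show ?thesis using xG X(4) by (simp add: m_ac)
      qed
      then have "{p \<in> P. p \<otimes> x \<in> S} = (\<lambda>s. inv y \<otimes> s) ` {s \<in> S. x \<otimes> inv y \<otimes> s \<in> S}"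
        by (auto simp: P_def)
      then have "card {p \<in> P. p \<otimes> x \<in> S} = card {s \<in> S. x \<otimes> inv y \<otimes> s \<in> S}"
        using injP by (simp add: card_image inj_on_subset)
      then show "K powr (-\<eta>) / 2 * real (card P + card S) \<le> real (card {p \<in> P. p \<otimes> x \<in> S})"
        using pop[OF x] cP by (simp add: S_def)
    next
      show "finite X'" using X(3) finX by (rule finite_subset)
      show "X' \<subseteq> carrier G" using X A by auto
    qed (use S cS cP A2 K X(4) in \<open>auto simp: P_def\<close>)
    have LA: "L \<subseteq> A" using L(1) X by auto
    then have finL: "finite L" using A(2) by (rule finite_subset)
    have "K powr (- E) * real (card A) \<le> K powr (- 3 * 2 ^ j) * real (card A)"
      using K jE by (intro mult_right_mono powr_mono) auto
    also have "\<dots> \<le> real (card X')" by (rule dens)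
    also have "\<dots> \<le> real (card (A \<inter> signed_span G L))"
      using X L(2) A by (intro of_nat_mono card_mono) auto
    finally have "K powr (- E) * real (card A) \<le> real (card (A \<inter> signed_span G L))" .
    moreover have "real (card L) \<le> 72 * (K powr \<eta> * ln (real (card A)))"
    proof -
      have "real (card L) / 2 = K powr \<eta> * (K powr (-\<eta>) / 2 * real (card L))"
        using K by (simp add: powr_minus)
      also have "\<dots> \<le> K powr \<eta> * (24 * ln (real (card A)))"
        using L(3) by (intro mult_left_mono) auto
      finally have "real (card L) \<le> 48 * (K powr \<eta> * ln (real (card A)))" by simp
      also have "\<dots> \<le> 72 * (K powr \<eta> * ln (real (card A)))"
        using lnA by (intro mult_right_mono) auto
      finally show ?thesis .
    qed
    ultimately show ?thesis using LA finL A(1) unfolding E_def by (intro exI[of _ L]) auto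
  qed
qed

end

section \<open>Transfer from groups on the natural numbers\<close>

text \<open>The products of integer powers of elements of \<open>A\<close> form a subgroup. It is
  countable because only the restriction of the exponents to the finite set \<open>A\<close>
  matters.\<close>

lemma (in comm_group) countable_subgroup:
  assumes A: "finite A" "A \<subseteq> carrier G"
  obtains H where "subgroup H G" "A \<subseteq> H" "countable H"
proof -
  define p where "p = (\<lambda>\<sigma>::'a \<Rightarrow> int. finprod G (\<lambda>x. x [^] \<sigma> x) A)"
  have closed: "(\<lambda>x. x [^] (\<sigma> x :: int)) \<in> A \<rightarrow> carrier G" for \<sigma>
    using A by auto
  have p_closed: "p \<sigma> \<in> carrier G" for \<sigma>
    unfolding p_def by (rule finprod_closed[OF closed])
  have p_mult: "p \<sigma> \<otimes> p \<tau> = p (\<lambda>x. \<sigma> x + \<tau> x)" for \<sigma> \<tau>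
    unfolding p_def finprod_multf[OF closed closed, symmetric]
    using A closed by (intro finprod_cong') (auto simp: int_pow_mult)
  have p_one: "p (\<lambda>x. 0) = \<one>"
    by (simp add: p_def)
  have p_inv: "inv (p \<sigma>) = p (\<lambda>x. - \<sigma> x)" for \<sigma>
    using p_mult[of "\<lambda>x. - \<sigma> x" \<sigma>] p_one p_closed by (intro inv_equality) auto
  have "subgroup (range p) G"
    by (rule subgroupI) (auto simp: p_closed p_inv p_mult)
  moreover have "A \<subseteq> range p"
  proof
    fix a assume a: "a \<in> A"
    have "p (\<lambda>x. if x = a then 1 else 0) = prd {a}"
      unfolding p_def using A a by (intro finprod_mono_neutral_cong_right) auto
    also have "\<dots> = a" using a A by (subst finprod_insert) auto
    finally show "a \<in> range p" by (metis rangeI)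
  qed
  moreover have "range p = p ` (A \<rightarrow>\<^sub>E UNIV)"
  proof -
    have "p \<sigma> = p (restrict \<sigma> A)" for \<sigma>
      unfolding p_def using closed[of "restrict \<sigma> A"] by (intro finprod_cong') auto
    then have "p \<sigma> \<in> p ` (A \<rightarrow>\<^sub>E UNIV)" for \<sigma>
      by (intro image_eqI[of _ _ "restrict \<sigma> A"]) auto
    then show ?thesis by auto
  qed
  then have "countable (range p)" using A(1) by (auto intro!: countable_image countable_PiE)
  ultimately show ?thesis using that by blast
qed

text \<open>The structure of a countable subgroup containing \<open>A\<close> is transported along
  an injection into \<open>nat\<close>. The map \<open>g\<close> points back to \<open>G\<close>, so
  that a set found in \<open>N\<close> can be pushed forward.\<close>

lemma (in comm_group) nat_copy:
  assumes A: "finite A" "A \<subseteq> carrier G"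
  obtains N :: "nat monoid" and g where "comm_group N" "g \<in> hom N G" "inj_on g (carrier N)"
    "A \<subseteq> g ` carrier N"
proof -
  obtain H where H: "subgroup H G" "A \<subseteq> H" "countable H"
    using countable_subgroup[OF A] .
  interpret H: subgroup H G by (rule H(1))
  obtain f :: "'a \<Rightarrow> nat" where f: "inj_on f H" using H(3) by (rule countableE)
  define g where "g = inv_into H f"
  have gf: "g (f x) = x" if "x \<in> H" for x using f that by (simp add: g_def)
  define N where "N = \<lparr>carrier = f ` H, monoid.mult = \<lambda>m n. f (g m \<otimes> g n), one = f \<one>\<rparr>"
  have "comm_group N"
  proof (rule comm_groupI)
    fix x assume "x \<in> carrier N"
    then obtain a where "a \<in> H" "x = f a" by (auto simp: N_def)
    then show "\<exists>y\<in>carrier N. y \<otimes>\<^bsub>N\<^esub> x = \<one>\<^bsub>N\<^esub>"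
      by (intro bexI[of _ "f (inv a)"]) (auto simp: N_def gf)
  qed (auto simp: N_def gf m_ac)
  moreover have "g \<in> hom N G"
    by (auto simp: hom_def N_def gf)
  moreover have "inj_on g (carrier N)"
    by (auto simp: N_def gf inj_on_def)
  moreover have "A \<subseteq> g ` carrier N"
    using H(2) by (force simp: N_def gf)
  ultimately show ?thesis using that by blast
qed

lemma hom_finprod:
  assumes "comm_group N" "comm_group G" "h \<in> hom N G" "F \<in> S \<rightarrow> carrier N"
  shows "h (finprod N F S) = finprod G (\<lambda>x. h (F x)) S"
proof -
  interpret N: comm_group N by fact
  interpret G: comm_group G by fact
  have hc: "h x \<in> carrier G" if "x \<in> carrier N" for x using assms(3) that by (rule hom_in_carrier)
  from assms(4) show ?thesis
  proof (induction S rule: infinite_finite_induct)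
    case (insert x S)
    then have "h (finprod N F (insert x S)) = h (F x) \<otimes>\<^bsub>G\<^esub> h (finprod N F S)"
      using hom_mult[OF assms(3)] by (simp add: Pi_iff)
    also have "\<dots> = finprod G (\<lambda>x. h (F x)) (insert x S)"
      using insert hc by (subst G.finprod_insert) auto
    finally show ?case .
  \<comment> \<open>Over an infinite index set both products are the identity by convention.\<close>
  qed (use hom_one[OF assms(3)] N.is_group G.is_group in auto)
qed

text \<open>By injectivity each element of the image of \<open>L\<close> has a single preimage in
  \<open>L\<close>, from which it inherits its coefficient.\<close>

lemma image_signed_span_subset:
  assumes "comm_group N" "comm_group G" "h \<in> hom N G" "inj_on h (carrier N)" "L \<subseteq> carrier N"
  shows "h ` signed_span N L \<subseteq> signed_span G (h ` L)"
proof
  interpret N: comm_group N by fact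
  interpret G: comm_group G by fact
  fix y assume "y \<in> h ` signed_span N L"
  then obtain \<sigma> :: "_ \<Rightarrow> int" where \<sigma>: "\<forall>x\<in>L. \<sigma> x \<in> {-1, 0, 1}"
    and y: "y = h (finprod N (\<lambda>x. x [^]\<^bsub>N\<^esub> \<sigma> x) L)"
    by (auto simp: signed_span_def)
  define \<tau> where "\<tau> = (\<lambda>z. \<sigma> (inv_into L h z))"
  have inj: "inj_on h L" using assms(4,5) by (rule inj_on_subset)
  have hc: "h x \<in> carrier G" if "x \<in> L" for x
    using assms(3,5) that by (auto intro: hom_in_carrier)
  have "y = finprod G (\<lambda>x. h (x [^]\<^bsub>N\<^esub> \<sigma> x)) L"
    unfolding y using assms by (intro hom_finprod) auto
  also have "\<dots> = finprod G (\<lambda>x. h x [^]\<^bsub>G\<^esub> \<tau> (h x)) L"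
    using assms(5) inj hc hom_int_pow[OF assms(3) _ N.is_group G.is_group]
    by (intro G.finprod_cong') (auto simp: \<tau>_def)
  also have "\<dots> = finprod G (\<lambda>z. z [^]\<^bsub>G\<^esub> \<tau> z) (h ` L)"
    using inj hc by (intro G.finprod_reindex[symmetric]) auto
  finally show "y \<in> signed_span G (h ` L)"
    using \<sigma> inj unfolding signed_span_def by (auto intro!: exI[of _ \<tau>] simp: \<tau>_def)
qed

text \<open>All that is known of \<open>implied_const\<close> concerns groups on \<open>nat\<close>,
  so the claim is applied to a copy on \<open>nat\<close> of a subgroup containing \<open>A\<close>
  and carried back to \<open>G\<close>.\<close>

theorem theorem1p3:
  fixes G :: "('a, 'b) monoid_scheme" and A :: "'a set" and K \<eta> :: real
  assumes "comm_group G"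
    and "A \<subseteq> carrier G" and "finite A" and "card A \<noteq> 1"
    and "real (card (A <#>\<^bsub>G\<^esub> A)) \<le> K * real (card A)"
    and "0 < \<eta>" and "\<eta> \<le> 1"
  shows "0 < implied_const \<and>
    (\<exists>L. L \<subseteq> carrier G \<and> finite L \<and>
       real (card (A \<inter> signed_span G L))
         \<ge> K powr (- (implied_const * exp (implied_const / \<eta>))) * real (card A) \<and>
       real (card L) \<le> implied_const * (K powr \<eta> * ln (real (card A))))"
proof -
  let ?P = "\<lambda>C. 0 < C \<and>
     (\<forall>(G :: nat monoid) A K \<eta>.
        comm_group G \<longrightarrow> A \<subseteq> carrier G \<longrightarrow> finite A \<longrightarrow> card A \<noteq> 1 \<longrightarrow>
        real (card (A <#>\<^bsub>G\<^esub> A)) \<le> K * real (card A) \<longrightarrow> 0 < \<eta> \<longrightarrow> \<eta> \<le> 1 \<longrightarrow>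
        (\<exists>L. L \<subseteq> carrier G \<and> finite L \<and>
           real (card (A \<inter> signed_span G L)) \<ge> K powr (- (C * exp (C / \<eta>))) * real (card A) \<and>
           real (card L) \<le> C * (K powr \<eta> * ln (real (card A)))))"
  \<comment> \<open>A witness, so that the value chosen by \<open>SOME\<close> has the required
    property.\<close>
  have "?P 72"
    by (intro conjI allI impI comm_group.large_intersection_with_span) auto
  then have C: "?P implied_const"
    unfolding implied_const_def by (rule someI[where P = ?P])
  interpret G: comm_group G by fact
  obtain N :: "nat monoid" and g where N: "comm_group N" and g: "g \<in> hom N G" "inj_on g (carrier N)"
    "A \<subseteq> g ` carrier N"
    using G.nat_copy[OF assms(3,2)] .
  interpret N: comm_group N by fact
  \<comment> \<open>\<open>g\<close> maps \<open>B\<close> bijectively onto \<open>A\<close> and the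
    product set of \<open>B\<close> injectively into that of \<open>A\<close>, so the doubling bound
    passes to \<open>B\<close>.\<close>
  define B where "B = {x \<in> carrier N. g x \<in> A}"
  have B: "B \<subseteq> carrier N" "g ` B = A" using g(3) by (auto simp: B_def)
  have injB: "inj_on g B" using g(2) B(1) by (rule inj_on_subset)
  have cB: "card B = card A" using card_image[OF injB] B(2) by simp
  have finB: "finite B" using finite_imageD[OF _ injB] B(2) assms(3) by simp
  have "B <#>\<^bsub>N\<^esub> B \<subseteq> carrier N"
    using B(1) by (intro N.set_mult_closed)
  then have "inj_on g (B <#>\<^bsub>N\<^esub> B)" using g(2) inj_on_subset by blast
  moreover have "g ` (B <#>\<^bsub>N\<^esub> B) \<subseteq> A <#>\<^bsub>G\<^esub> A"
  proof (clarsimp simp: set_mult_def)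
    fix x y assume xy: "x \<in> B" "y \<in> B"
    then have "g (x \<otimes>\<^bsub>N\<^esub> y) = g x \<otimes>\<^bsub>G\<^esub> g y"
      using B(1) by (intro hom_mult[OF g(1)]) auto
    then show "\<exists>a\<in>A. \<exists>b\<in>A. g (x \<otimes>\<^bsub>N\<^esub> y) = a \<otimes>\<^bsub>G\<^esub> b"
      using xy B(2) by blast
  qed
  ultimately have "card (B <#>\<^bsub>N\<^esub> B) \<le> card (A <#>\<^bsub>G\<^esub> A)"
    using G.finite_set_mult[OF assms(3,3)] by (rule card_inj_on_le)
  then have dblB: "real (card (B <#>\<^bsub>N\<^esub> B)) \<le> K * real (card B)" using assms(5) cB by simp
  have "card B \<noteq> 1" using assms(4) cB by simp
  then obtain L where L: "L \<subseteq> carrier N" "finite L"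
    "K powr (- (implied_const * exp (implied_const / \<eta>))) * real (card A) \<le> real (card (B \<inter> signed_span N L))"
    "real (card L) \<le> implied_const * (K powr \<eta> * ln (real (card A)))"
    using C[THEN conjunct2, rule_format, OF N B(1) finB \<open>card B \<noteq> 1\<close> dblB assms(6,7)]
    unfolding cB by blast
  have "g ` L \<subseteq> carrier G" using L(1) g(1) by (auto intro: hom_in_carrier)
  moreover have "card (B \<inter> signed_span N L) \<le> card (A \<inter> signed_span G (g ` L))"
  proof (rule card_inj_on_le)
    show "inj_on g (B \<inter> signed_span N L)" using injB by (rule inj_on_subset) auto
    show "g ` (B \<inter> signed_span N L) \<subseteq> A \<inter> signed_span G (g ` L)"
      using image_signed_span_subset[OF N assms(1) g(1,2) L(1)] B(2) by blast
  qed (use assms(3) in simp)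
  moreover have "card (g ` L) \<le> card L" using L(2) by (rule card_image_le)
  ultimately show ?thesis
    using C L by (intro conjI exI[of _ "g ` L"]) auto
qed

end
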